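(* Let $D$ be an Eulerian digraph, let $S\subseteq V(D)$ with $|S|\ge 2$, let $r\in S$, and let $\ell\ge 1$ be an integer. Then $\lambda_{S,r}(D)\geq \ell$ if and only if $\lambda_D(r,s)\geq \ell$ for all $s\in S\setminus\{r\}$.
   Context: Digraphs are finite and have no parallel arcs or loops. A digraph is Eulerian if it is connected and every vertex $x$ satisfies $d^+(x)=d^-(x)$. An out-tree is an oriented tree in which every vertex except one, called the root, has in-degree one. For a digraph $D$ and $S\subseteq V(D)$ with $r\in S$ and $|S|\ge 2$, an $(S,r)$-tree is an out-tree $T$ in $D$ rooted at $r$ with $S\subseteq V(T)$. Two $(S,r)$-trees $T_1,T_2$ are arc-disjoint if $A(T_1)\cap A(T_2)=\emptyset$. $\lambda_{S,r}(D)$ denotes the maximum number of pairwise arc-disjoint $(S,r)$-trees in $D$. $\lambda_D(x,y)$ denotes the maximum number of pairwise arc-disjoint directed $(x,y)$-paths in $D$. *)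

theory Defs
  imports "Graph_Theory.Digraph_Component"
begin

text \<open>Digraphs are those of the locale \<^locale>\<open>digraph\<close>: finite, without loops and without parallel arcs
  (pairs of opposite arcs are allowed). \<^const>\<open>connected\<close> refers to the underlying undirected graph.\<close>

definition eulerian :: "('a, 'b) pre_digraph \<Rightarrow> bool" where
  "eulerian D \<longleftrightarrow> digraph D \<and> connected D \<and> (\<forall>x \<in> verts D. out_degree D x = in_degree D x)"

text \<open>An oriented tree is an orientation of an undirected tree: no two arcs are opposite, and the
  underlying undirected graph is connected and acyclic. The library predicate \<^const>\<open>tree\<close> is not
  suitable here: \<^const>\<open>forest\<close> only excludes directed cycles of the digraph it is applied to, and
  applied to \<^const>\<open>mk_symmetric\<close> it would also exclude every edge, as the closed walk \<open>u, v, u\<close>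
  counts as a \<^const>\<open>pre_digraph.cycle\<close>. Undirected cycles are the cycles of \<^const>\<open>mk_symmetric\<close> of
  length at least 3.\<close>

definition oriented_tree :: "('a, 'b) pre_digraph \<Rightarrow> bool" where
  "oriented_tree T \<longleftrightarrow> digraph T \<and> asym (arcs_ends T) \<and> connected T \<and>
     \<not> (\<exists>c. pre_digraph.cycle (with_proj (mk_symmetric T)) c \<and> 3 \<le> length c)"

definition out_tree :: "('a, 'b) pre_digraph \<Rightarrow> 'a \<Rightarrow> bool" where
  "out_tree T r \<longleftrightarrow> oriented_tree T \<and> r \<in> verts T \<and>
     (\<forall>v \<in> verts T. in_degree T v = 1 \<longleftrightarrow> v \<noteq> r)"

definition steiner_out_tree :: "('a, 'b) pre_digraph \<Rightarrow> 'a set \<Rightarrow> 'a \<Rightarrow> ('a, 'b) pre_digraph \<Rightarrow> bool" where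
  "steiner_out_tree D S r T \<longleftrightarrow> subgraph T D \<and> out_tree T r \<and> S \<subseteq> verts T"

text \<open>Families of trees and of paths are sets. This loses nothing when \<open>card S \<ge> 2\<close> and \<open>x \<noteq> y\<close>: all
  members then have an arc, so arc-disjoint members are distinct. In a finite digraph the maxima
  range over finite nonempty sets of numbers.\<close>

definition tree_connectivity :: "('a, 'b) pre_digraph \<Rightarrow> 'a set \<Rightarrow> 'a \<Rightarrow> nat" where
  "tree_connectivity D S r = Max {card F | F. F \<subseteq> {T. steiner_out_tree D S r T} \<and>
     pairwise (\<lambda>T1 T2. arcs T1 \<inter> arcs T2 = {}) F}"

definition arc_connectivity :: "('a, 'b) pre_digraph \<Rightarrow> 'a \<Rightarrow> 'a \<Rightarrow> nat" where
  "arc_connectivity D x y = Max {card F | F. F \<subseteq> {p. pre_digraph.apath D x p y} \<and>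
     pairwise (\<lambda>p q. set p \<inter> set q = {}) F}"

end

theory Submission
  imports Defs
begin

text \<open>
  If \<open>l\<close> arc-disjoint trees rooted at \<open>r\<close> span \<open>S\<close>, each of them contains a path from \<open>r\<close> to any
  given \<open>s \<in> S\<close>, and these paths are arc-disjoint
  (\<open>tree_connectivity_le_arc_connectivity\<close>). The work is in the converse.

  Only cuts matter there. If \<open>l\<close> arc-disjoint paths lead from \<open>r\<close> to each \<open>s \<in> S\<close>, then at least
  \<open>l\<close> arcs enter every set that avoids \<open>r\<close> and meets \<open>S\<close>. In a digraph with equal in- and
  out-degrees as many arcs enter a set as leave it, so the condition takes a form in which the root
  has disappeared: at least \<open>l\<close> arcs enter every set \<open>X\<close> that separates \<open>S\<close>, that is, for which
  both \<open>X\<close> and its complement meet \<open>S\<close>.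

  This condition survives the removal of the vertices outside \<open>S\<close> by splitting off. For an arc
  \<open>b = vw\<close> with \<open>v \<notin> S\<close> some arc \<open>a = uv\<close> exists such that replacing the pair by one arc \<open>uw\<close> keeps
  the condition (\<open>splitting_off\<close>). A pair can be split unless a separating set entered by exactly
  \<open>l\<close> arcs contains \<open>u\<close> and \<open>w\<close> but not \<open>v\<close>. Such tight sets are closed under union
  (\<open>tight_union\<close>), so if no pair could be split, one tight set would contain \<open>w\<close> and all
  in-neighbours of \<open>v\<close>; adding \<open>v\<close> to it would give a separating set entered by fewer than \<open>l\<close> arcs.

  Once all arcs live inside \<open>S\<close>, Edmonds' branching theorem yields \<open>l\<close> disjoint arc sets in each of
  which \<open>r\<close> reaches all of \<open>S\<close> (\<open>edmonds_branchings\<close>). Undoing the splittings one by one, with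
  \<open>uw\<close> replaced by the path through \<open>v\<close>, preserves disjointness and reachability
  (\<open>packs_unsplit\<close>, \<open>balanced_packing\<close>). Finally every arc set in which \<open>r\<close> reaches \<open>S\<close> contains
  an out-tree that spans \<open>S\<close>: a tree of shortest walks from \<open>r\<close> (\<open>steiner_out_tree_exists\<close>).

  Splitting off creates loops and parallel arcs. The middle part is therefore about an arbitrary
  finite set \<open>A\<close> of arcs with a tail function \<open>t\<close> and a head function \<open>h\<close>. The new arc \<open>uw\<close> reuses
  the name \<open>a\<close>, so that splitting off deletes \<open>b\<close> from \<open>A\<close> and changes \<open>h\<close> at \<open>a\<close>.
\<close>

section \<open>Cuts in multidigraphs\<close>

definition in_cut :: "'b set \<Rightarrow> ('b \<Rightarrow> 'a) \<Rightarrow> ('b \<Rightarrow> 'a) \<Rightarrow> 'a set \<Rightarrow> nat" where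
  "in_cut A t h X = card {a \<in> A. t a \<notin> X \<and> h a \<in> X}"

definition balanced :: "'b set \<Rightarrow> ('b \<Rightarrow> 'a) \<Rightarrow> ('b \<Rightarrow> 'a) \<Rightarrow> bool" where
  "balanced A t h \<longleftrightarrow> (\<forall>v. card {a \<in> A. t a = v} = card {a \<in> A. h a = v})"

abbreviation arc_rel :: "('b \<Rightarrow> 'a) \<Rightarrow> ('b \<Rightarrow> 'a) \<Rightarrow> 'b set \<Rightarrow> ('a \<times> 'a) set" where
  "arc_rel t h B \<equiv> (\<lambda>a. (t a, h a)) ` B"

text \<open>A packing records only which vertices its arc sets reach and leaves out the tree structure, so that
a split arc can be replaced by a walk of two arcs without any pruning.\<close>

definition packs :: "'b set \<Rightarrow> ('b \<Rightarrow> 'a) \<Rightarrow> ('b \<Rightarrow> 'a) \<Rightarrow> 'a \<Rightarrow> 'a set \<Rightarrow> nat \<Rightarrow> bool" where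
  "packs A t h r S l \<longleftrightarrow> (\<exists>B :: nat \<Rightarrow> 'b set.
     (\<forall>i<l. B i \<subseteq> A \<and> (\<forall>s\<in>S. (r, s) \<in> (arc_rel t h (B i))\<^sup>*)) \<and>
     (\<forall>i<l. \<forall>j<l. i \<noteq> j \<longrightarrow> B i \<inter> B j = {}))"

lemma packs_mono:
  assumes "packs A t h r S l" "A \<subseteq> A'"
  shows "packs A' t h r S l"
proof -
  obtain B where B: "\<forall>i<l. B i \<subseteq> A \<and> (\<forall>s\<in>S. (r, s) \<in> (arc_rel t h (B i))\<^sup>*)"
    "\<forall>i<l. \<forall>j<l. i \<noteq> j \<longrightarrow> B i \<inter> B j = {}"
    using assms(1) unfolding packs_def by (elim exE conjE)
  from B(1) assms(2) have "\<forall>i<l. B i \<subseteq> A' \<and> (\<forall>s\<in>S. (r, s) \<in> (arc_rel t h (B i))\<^sup>*)"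
    by (meson subset_trans)
  with B(2) show ?thesis unfolding packs_def by (intro exI conjI)
qed

definition separates :: "'a set \<Rightarrow> 'a set \<Rightarrow> bool" where
  "separates X S \<longleftrightarrow> X \<inter> S \<noteq> {} \<and> S - X \<noteq> {}"

text \<open>With cuts written as sums over arcs, uncrossing inequalities can be checked arc by arc.\<close>

lemma card_filter_eq_sum:
  assumes "finite A"
  shows "card {a \<in> A. P a} = (\<Sum>a\<in>A. of_bool (P a))"
  using assms by (simp add: sum_of_bool_eq Int_def)

lemma in_cut_eq_sum:
  assumes "finite A"
  shows "in_cut A t h X = (\<Sum>a\<in>A. of_bool (t a \<notin> X \<and> h a \<in> X))"
  unfolding in_cut_def using assms by (rule card_filter_eq_sum)

lemma in_cut_pos_arc:
  assumes "0 < in_cut A t h X"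
  obtains a where "a \<in> A" "t a \<notin> X" "h a \<in> X"
  using assms unfolding in_cut_def by (auto simp: card_gt_0_iff)

lemma in_cut_remove:
  assumes "finite A" "b \<in> A"
  shows "in_cut A t h X = of_bool (t b \<notin> X \<and> h b \<in> X) + in_cut (A - {b}) t h X"
  using assms by (simp add: in_cut_eq_sum sum.remove del: sum_of_bool_eq)

lemma in_cut_submodular:
  assumes "finite A"
  shows "in_cut A t h (X \<inter> Y) + in_cut A t h (X \<union> Y) \<le> in_cut A t h X + in_cut A t h Y"
  unfolding in_cut_eq_sum[OF assms] sum.distrib[symmetric]
  by (rule sum_mono) (auto simp: of_bool_def)

lemma balanced_card_set:
  assumes "finite A" "balanced A t h"
  shows "card {a \<in> A. t a \<in> X} = card {a \<in> A. h a \<in> X}"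
proof -
  define W where "W = X \<inter> (t ` A \<union> h ` A)"
  have fW: "finite W" using assms(1) by (auto simp: W_def)
  have fibres: "card {a \<in> A. f a \<in> X} = (\<Sum>v\<in>W. card {a \<in> A. f a = v})"
    if "f ` A \<subseteq> t ` A \<union> h ` A" for f
  proof -
    have "{a \<in> A. f a \<in> X} = (\<Union>v\<in>W. {a \<in> A. f a = v})"
      using that by (auto simp: W_def)
    then show ?thesis using assms(1) fW by (simp add: card_UN_disjoint disjoint_iff)
  qed
  show ?thesis using assms(2) by (simp add: fibres balanced_def)
qed

text \<open>The arcs with tail in \<open>X\<close> and those with head in \<open>X\<close> are equally many; both counts include the arcs
inside \<open>X\<close>, and cancelling these leaves the arcs that leave \<open>X\<close> and the arcs that enter it.\<close>

lemma balanced_in_cut_Compl: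
  assumes "finite A" "balanced A t h"
  shows "in_cut A t h (- X) = in_cut A t h X"
proof -
  have "card {a \<in> A. t a \<in> X} = in_cut A t h (- X) + card {a \<in> A. t a \<in> X \<and> h a \<in> X}"
    unfolding in_cut_def using assms(1) 
    by (subst card_Un_disjoint[symmetric]) (auto intro!: arg_cong[where f=card])
  moreover have "card {a \<in> A. h a \<in> X} = in_cut A t h X + card {a \<in> A. t a \<in> X \<and> h a \<in> X}"
    unfolding in_cut_def using assms(1) 
    by (subst card_Un_disjoint[symmetric]) (auto intro!: arg_cong[where f=card])
  ultimately show ?thesis using balanced_card_set[OF assms, of X] by simp
qed

lemma separates_Compl [simp]: "separates (- X) S \<longleftrightarrow> separates X S"
  by (auto simp: separates_def)

section \<open>Edmonds' disjoint branchings\<close>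

text \<open>The step of Lovasz's proof of Edmonds' theorem. \<open>B\<close> is a partial branching with vertex set \<open>U\<close>, and
the remaining arcs still enter every set at least \<open>l\<close> times. An arc \<open>e\<close> leaving \<open>U\<close> may be added to
\<open>B\<close> unless it enters a tight set, one that is entered exactly \<open>l\<close> times. It is taken inside a smallest
tight set \<open>X\<close> that sticks out of \<open>U\<close>: there \<open>X - U\<close> is entered more often than \<open>X\<close> because \<open>B\<close> uses
no arc into it, so some arc leads from \<open>X \<inter> U\<close> to \<open>X - U\<close>. If it entered a tight set \<open>Y\<close>, then
\<open>X \<inter> Y\<close> would be tight by submodularity, would stick out of \<open>U\<close> and would be smaller than \<open>X\<close>.\<close>

lemma branching_extend:
  assumes "finite A" "finite V" "\<forall>a\<in>A. t a \<in> V \<and> h a \<in> V"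
    and cut: "\<And>X. X \<subseteq> V - {r} \<Longrightarrow> X \<noteq> {} \<Longrightarrow> Suc l \<le> in_cut A t h X"
    and U: "r \<in> U" "U \<subset> V" and B: "B \<subseteq> A" "\<forall>a\<in>B. h a \<in> U"
    and rest: "\<And>X. X \<subseteq> V - {r} \<Longrightarrow> X \<noteq> {} \<Longrightarrow> l \<le> in_cut (A - B) t h X"
  obtains e where "e \<in> A - B" "t e \<in> U" "h e \<in> V - U"
    "\<And>X. X \<subseteq> V - {r} \<Longrightarrow> X \<noteq> {} \<Longrightarrow> l \<le> in_cut (A - insert e B) t h X"
proof -
  let ?d = "in_cut (A - B) t h"
  have fin: "finite (A - B)" using assms(1) by simp
  have outside: "Suc l \<le> ?d X" if "X \<subseteq> V - U" "X \<noteq> {}" for X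
  proof -
    have "?d X = in_cut A t h X"
      unfolding in_cut_def using that B by (intro arg_cong[where f=card]) blast
    then show ?thesis using cut[of X] that U by auto
  qed
  define tight where "tight X \<longleftrightarrow> X \<subseteq> V - {r} \<and> ?d X \<le> l" for X
  have "\<exists>e \<in> A - B. t e \<in> U \<and> h e \<in> V - U \<and> (\<forall>Y. tight Y \<longrightarrow> h e \<in> Y \<longrightarrow> t e \<in> Y)"
  proof (cases "\<exists>X. tight X \<and> X - U \<noteq> {}")
    case True
    then obtain X where X: "tight X" "X - U \<noteq> {}"
      and min: "\<And>Y. tight Y \<Longrightarrow> Y - U \<noteq> {} \<Longrightarrow> card X \<le> card Y"
      using ex_has_least_nat[of "\<lambda>X. tight X \<and> X - U \<noteq> {}" _ card] by blast
    have XV: "X \<subseteq> V - {r}" "?d X \<le> l" using X by (auto simp: tight_def)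
    have "?d X < ?d (X - U)" using outside[of "X - U"] XV X(2) by fastforce
    moreover have "?d (X - U) \<le> ?d X"
      if "{a \<in> A - B. t a \<notin> X - U \<and> h a \<in> X - U} \<subseteq> {a \<in> A - B. t a \<notin> X \<and> h a \<in> X}"
      unfolding in_cut_def using that by (intro card_mono) (auto intro: finite_subset[OF _ fin])
    ultimately have "\<not> {a \<in> A - B. t a \<notin> X - U \<and> h a \<in> X - U} \<subseteq> {a \<in> A - B. t a \<notin> X \<and> h a \<in> X}"
      by linarith
    then obtain e where e: "e \<in> A - B" "t e \<in> X \<inter> U" "h e \<in> X - U" by blast
    have "t e \<in> Y" if Y: "tight Y" "h e \<in> Y" for Y
    proof (rule ccontr)
      assume "t e \<notin> Y"
      have "?d (X \<inter> Y) + ?d (X \<union> Y) \<le> ?d X + ?d Y" by (rule in_cut_submodular[OF fin])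
      moreover have "l \<le> ?d (X \<union> Y)" using XV Y e by (intro rest) (auto simp: tight_def)
      ultimately have "tight (X \<inter> Y)" using XV Y by (auto simp: tight_def)
      then have "card X \<le> card (X \<inter> Y)" using min[of "X \<inter> Y"] e Y by blast
      moreover have "card (X \<inter> Y) < card X"
        using XV(1) assms(2) e \<open>t e \<notin> Y\<close>
        by (intro psubset_card_mono) (auto intro: finite_subset)
      ultimately show False by simp
    qed
    then show ?thesis using e XV by blast
  next
    case False
    \<comment> \<open>Without a tight set that sticks out of \<open>U\<close>, every arc leaving \<open>U\<close> is safe.\<close>
    have "0 < ?d (V - U)" using outside[of "V - U"] U by fastforce
    then obtain e where "e \<in> A - B" "t e \<notin> V - U" "h e \<in> V - U" by (rule in_cut_pos_arc)
    then show ?thesis using False assms(3) by blast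
  qed
  then obtain e where e: "e \<in> A - B" "t e \<in> U" "h e \<in> V - U"
    and safe: "\<And>Y. tight Y \<Longrightarrow> h e \<in> Y \<Longrightarrow> t e \<in> Y" by blast
  have "l \<le> in_cut (A - insert e B) t h X" if X: "X \<subseteq> V - {r}" "X \<noteq> {}" for X
  proof -
    have "A - insert e B = A - B - {e}" by blast
    then have "?d X = of_bool (t e \<notin> X \<and> h e \<in> X) + in_cut (A - insert e B) t h X"
      using in_cut_remove[OF fin e(1), of t h X] by simp
    moreover have "l < ?d X" if "t e \<notin> X \<and> h e \<in> X"
      using safe[of X] that X by (auto simp: tight_def)
    ultimately show ?thesis using rest[OF X] by (cases "t e \<notin> X \<and> h e \<in> X") auto
  qed
  then show thesis using e that by blast
qed

text \<open>One branching can be split away at the cost of one unit of connectivity, by extending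
the trivial branching at \<open>r\<close> arc by arc. This is the induction step of Edmonds' theorem.\<close>

lemma spanning_branching:
  assumes "finite A" "finite V" "\<forall>a\<in>A. t a \<in> V \<and> h a \<in> V" "r \<in> V"
    and cut: "\<And>X. X \<subseteq> V - {r} \<Longrightarrow> X \<noteq> {} \<Longrightarrow> Suc l \<le> in_cut A t h X"
  obtains B where "B \<subseteq> A" "\<forall>v\<in>V. (r, v) \<in> (arc_rel t h B)\<^sup>*"
    "\<And>X. X \<subseteq> V - {r} \<Longrightarrow> X \<noteq> {} \<Longrightarrow> l \<le> in_cut (A - B) t h X"
proof -
  define good where "good B \<longleftrightarrow> B \<subseteq> A \<and> (\<forall>X. X \<subseteq> V - {r} \<longrightarrow> X \<noteq> {} \<longrightarrow> l \<le> in_cut (A - B) t h X)" for B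
  have grow: "\<exists>B. good B \<and> (\<forall>v\<in>V. (r, v) \<in> (arc_rel t h B)\<^sup>*)"
    if "r \<in> U" "U \<subseteq> V" "good B" "\<forall>a\<in>B. h a \<in> U" "\<forall>v\<in>U. (r, v) \<in> (arc_rel t h B)\<^sup>*" for U B
    using that
  proof (induction "card (V - U)" arbitrary: U B rule: less_induct)
    case less
    show ?case
    proof (cases "U = V")
      case True
      then show ?thesis using less.prems by blast
    next
      case False
      obtain e where e: "e \<in> A - B" "t e \<in> U" "h e \<in> V - U"
        and rest: "\<And>X. X \<subseteq> V - {r} \<Longrightarrow> X \<noteq> {} \<Longrightarrow> l \<le> in_cut (A - insert e B) t h X"
      proof -
        have "U \<subset> V" "B \<subseteq> A" using less.prems(2,3) False by (auto simp: good_def)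
        moreover have "l \<le> in_cut (A - B) t h X" if "X \<subseteq> V - {r}" "X \<noteq> {}" for X
          using less.prems(3) that by (simp add: good_def)
        ultimately show thesis
          using branching_extend[OF assms(1-3) cut less.prems(1) _ _ less.prems(4)] that by blast
      qed
      show ?thesis
      proof (rule less.hyps)
        show "card (V - insert (h e) U) < card (V - U)"
          using e assms(2) by (intro psubset_card_mono) auto
        show "good (insert e B)" using rest e less.prems(3) by (auto simp: good_def)
        have mono: "(arc_rel t h B)\<^sup>* \<subseteq> (arc_rel t h (insert e B))\<^sup>*" by (intro rtrancl_mono) auto
        have "(r, t e) \<in> (arc_rel t h (insert e B))\<^sup>*" using mono e less.prems(5) by blast
        then have "(r, h e) \<in> (arc_rel t h (insert e B))\<^sup>*"
          by (rule rtrancl_into_rtrancl) simp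
        then show "\<forall>v\<in>insert (h e) U. (r, v) \<in> (arc_rel t h (insert e B))\<^sup>*"
          using mono less.prems(5) by blast
      qed (use e less.prems in auto)
    qed
  qed
  moreover have "good {}" using cut by (auto simp: good_def intro: Suc_leD)
  ultimately have "\<exists>B. good B \<and> (\<forall>v\<in>V. (r, v) \<in> (arc_rel t h B)\<^sup>*)"
    using grow[of "{r}" "{}"] assms(4) by simp
  then show thesis using that by (auto simp: good_def)
qed

theorem edmonds_branchings:
  assumes "finite A" "finite V" "\<forall>a\<in>A. t a \<in> V \<and> h a \<in> V" "r \<in> V"
    and "\<And>X. X \<subseteq> V - {r} \<Longrightarrow> X \<noteq> {} \<Longrightarrow> l \<le> in_cut A t h X"
  shows "packs A t h r V l"
  using assms
proof (induction l arbitrary: A)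
  case 0
  then show ?case by (simp add: packs_def)
next
  case (Suc l)
  obtain C where C: "C \<subseteq> A" "\<forall>v\<in>V. (r, v) \<in> (arc_rel t h C)\<^sup>*"
    and rest: "\<And>X. X \<subseteq> V - {r} \<Longrightarrow> X \<noteq> {} \<Longrightarrow> l \<le> in_cut (A - C) t h X"
    using spanning_branching[OF Suc.prems] by blast
  have "packs (A - C) t h r V l" using Suc.prems rest by (intro Suc.IH) auto
  then obtain B where B: "\<forall>i<l. B i \<subseteq> A - C \<and> (\<forall>s\<in>V. (r, s) \<in> (arc_rel t h (B i))\<^sup>*)"
     "\<forall>i<l. \<forall>j<l. i \<noteq> j \<longrightarrow> B i \<inter> B j = {}" unfolding packs_def by blast
  show ?case unfolding packs_def
  proof (intro exI[of _ "B(l := C)"] conjI allI impI)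
    fix i j assume "i < Suc l" "j < Suc l" "i \<noteq> j"
    then show "(B(l := C)) i \<inter> (B(l := C)) j = {}"
      using B by (cases "i = l"; cases "j = l") (force simp: less_Suc_eq)+
  next
    fix i assume "i < Suc l"
    then show "(B(l := C)) i \<subseteq> A" "\<forall>s\<in>V. (r, s) \<in> (arc_rel t h ((B(l := C)) i))\<^sup>*"
      using B C by (auto simp: less_Suc_eq)
  qed
qed

section \<open>Splitting off in balanced digraphs\<close>

text \<open>At the vertex \<open>h a = t b\<close> one arc in and one arc out disappear; all other degrees are unchanged.\<close>

lemma balanced_split:
  assumes "finite A" "balanced A t h" "a \<in> A" "b \<in> A" "a \<noteq> b" "h a = t b"
  shows "balanced (A - {b}) t (h(a := h b))"
  unfolding balanced_def
proof
  fix v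
  define C where "C = A - {b} - {a}"
  have AC: "A = insert b (insert a C)" "A - {b} = insert a C" "finite C" "a \<notin> C" "b \<notin> insert a C"
    using assms by (auto simp: C_def)
  let ?h = "h(a := h b)"
  have eq: "(\<Sum>c\<in>C. of_bool (?h c = v) :: nat) = (\<Sum>c\<in>C. of_bool (h c = v))"
    using AC by (intro sum.cong) auto
  have "(\<Sum>c\<in>A. of_bool (t c = v) :: nat) = (\<Sum>c\<in>A. of_bool (h c = v))"
    using assms(1,2) by (simp only: balanced_def card_filter_eq_sum)
  then have "(\<Sum>c\<in>A - {b}. of_bool (t c = v) :: nat) = (\<Sum>c\<in>A - {b}. of_bool (?h c = v))"
    using AC assms(6) eq by (simp del: sum_of_bool_eq)
  then show "card {c \<in> A - {b}. t c = v} = card {c \<in> A - {b}. ?h c = v}"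
    using assms(1) by (simp only: card_filter_eq_sum finite_Diff)
qed

text \<open>A set without the middle vertex \<open>t b\<close> loses an entering arc exactly when it contains both outer
ends: the arc \<open>b\<close> entered it, and the new arc lies inside. Sets that contain the middle vertex are
handled through their complements.\<close>

lemma in_cut_split:
  assumes "finite A" "a \<in> A" "b \<in> A" "a \<noteq> b" "h a = t b" "t b \<notin> X"
  shows "in_cut A t h X
    = in_cut (A - {b}) t (h(a := h b)) X + of_bool (t a \<in> X \<and> h b \<in> X)"
proof -
  define C where "C = A - {b} - {a}"
  have AC: "A = insert b (insert a C)" "A - {b} = insert a C" "finite C" "a \<notin> C" "b \<notin> insert a C"
    using assms by (auto simp: C_def)
  have eq: "in_cut C t (h(a := h b)) X = in_cut C t h X"
    unfolding in_cut_def using AC by (intro arg_cong[where f=card]) auto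
  have "in_cut A t h X = of_bool (h b \<in> X) + in_cut C t h X"
    using in_cut_remove[of A b t h X] in_cut_remove[of "A - {b}" a t h X] assms by (simp add: C_def)
  moreover have "in_cut (A - {b}) t (h(a := h b)) X = of_bool (t a \<notin> X \<and> h b \<in> X) + in_cut C t h X"
    using in_cut_remove[of "A - {b}" a t "h(a := h b)" X] assms eq by (simp add: C_def)
  ultimately show ?thesis by auto
qed

text \<open>Submodularity for \<open>X\<close> and \<open>Y\<close> makes the union tight if intersection and union both separate \<open>S\<close>.
Otherwise \<open>S\<close> misses the intersection or the outside of the union, and then both differences
separate \<open>S\<close>. In a balanced digraph submodularity also holds for \<open>X\<close> and the complement of \<open>Y\<close>, which
bounds the differences, and there the arc \<open>b\<close>, leading from outside \<open>X \<union> Y\<close> into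
\<open>X \<inter> Y\<close>, makes it strict: the differences cannot both be entered \<open>l\<close> times.\<close>

lemma tight_union:
  assumes "finite A" "balanced A t h"
    and cut: "\<And>X. separates X S \<Longrightarrow> l \<le> in_cut A t h X"
    and b: "b \<in> A" "t b \<notin> X" "t b \<notin> Y" "h b \<in> X" "h b \<in> Y"
    and X: "separates X S" "in_cut A t h X \<le> l"
    and Y: "separates Y S" "in_cut A t h Y \<le> l"
  shows "separates (X \<union> Y) S \<and> in_cut A t h (X \<union> Y) \<le> l"
proof -
  let ?d = "in_cut A t h"
  have "\<not> (separates (X - Y) S \<and> separates (Y - X) S)"
  proof
    assume sep: "separates (X - Y) S \<and> separates (Y - X) S"
    \<comment> \<open>Applying submodularity without \<open>b\<close> and putting \<open>b\<close> back gives the strict inequality,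
      since \<open>b\<close> counts for \<open>X\<close> and for none of the other three sets.\<close>
    let ?d' = "in_cut (A - {b}) t h"
    have "?d' (X \<inter> - Y) + ?d' (X \<union> - Y) \<le> ?d' X + ?d' (- Y)"
      using assms(1) by (intro in_cut_submodular) simp
    moreover have "?d (X \<inter> - Y) = ?d' (X \<inter> - Y)" "?d (X \<union> - Y) = ?d' (X \<union> - Y)"
      "?d X = Suc (?d' X)" "?d (- Y) = ?d' (- Y)"
      using b by (simp_all add: in_cut_remove[OF assms(1) b(1)])
    moreover have "?d (- Y) = ?d Y" by (rule balanced_in_cut_Compl[OF assms(1,2)])
    moreover have "?d (X \<union> - Y) = ?d (Y - X)"
      using balanced_in_cut_Compl[OF assms(1,2), of "Y - X"] by (simp add: Compl_Diff_eq Un_commute)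
    moreover have "l \<le> ?d (X \<inter> - Y)" "l \<le> ?d (Y - X)"
      using sep cut by (auto simp: Diff_eq)
    ultimately show False using X Y by linarith
  qed
  then have sep: "separates (X \<inter> Y) S" "separates (X \<union> Y) S"
    using X Y unfolding separates_def by blast+
  then show ?thesis
    using in_cut_submodular[OF assms(1), of t h X Y] cut[OF sep(1)] X Y by auto
qed

text \<open>The terminal case of Jackson's theorem on splitting off in Eulerian digraphs. The obstacle to
splitting \<open>a\<close> with \<open>b\<close> is a critical set \<open>X\<close>: tight, without \<open>v = t b\<close>, with both outer ends inside.
If every arc into \<open>v\<close> had one, their union \<open>X\<close> would be critical and contain all in-neighbours of
\<open>v\<close>. Then nothing enters \<open>insert v X\<close> at \<open>v\<close>, while \<open>b\<close> enters \<open>X\<close> but not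
\<open>insert v X\<close>, which contradicts the lower bound for \<open>insert v X\<close>.\<close>

lemma splitting_off:
  assumes "finite A" "balanced A t h"
    and cut: "\<And>X. separates X S \<Longrightarrow> l \<le> in_cut A t h X"
    and b: "b \<in> A" "t b \<notin> S" "h b \<noteq> t b"
  obtains a where "a \<in> A" "a \<noteq> b" "h a = t b"
    "\<And>X. separates X S \<Longrightarrow> l \<le> in_cut (A - {b}) t (h(a := h b)) X"
proof (rule ccontr)
  note split = that
  assume contr: "\<not> thesis"
  let ?d = "in_cut A t h"
  define v where "v = t b"
  define I where "I = {a \<in> A. h a = v \<and> t a \<noteq> v}"
  define crit where "crit X \<longleftrightarrow> separates X S \<and> v \<notin> X \<and> h b \<in> X \<and> ?d X \<le> l" for X
  \<comment> \<open>By balance, the arc \<open>b\<close> out of \<open>v\<close> forces an arc into \<open>v\<close> that is not a loop.\<close>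
  have "0 < ?d (- {v})" 
    unfolding in_cut_def using b assms(1) by (auto simp: card_gt_0_iff v_def)
  then have "0 < ?d {v}" by (simp add: balanced_in_cut_Compl[OF assms(1,2)])
  then have "I \<noteq> {}" by (rule in_cut_pos_arc) (auto simp: I_def)
  have bad: "\<exists>X. crit X \<and> t a \<in> X" if "a \<in> I" for a
  proof -
    have a: "a \<in> A" "a \<noteq> b" "h a = t b" using that b by (auto simp: I_def v_def)
    let ?d' = "in_cut (A - {b}) t (h(a := h b))"
    obtain Y where Y: "separates Y S" "?d' Y < l"
      using contr split[OF a] by (meson not_le)
    \<comment> \<open>The split digraph is balanced too, so a violated set may be assumed to avoid \<open>v\<close>.\<close>
    have "?d' (- Y) = ?d' Y"
      using balanced_split[OF assms(1,2) a(1) b(1) a(2,3)] assms(1)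
      by (intro balanced_in_cut_Compl) auto
    then obtain X where X: "separates X S" "?d' X < l" "v \<notin> X"
      using Y by (metis ComplI separates_Compl ComplD)
    then have "?d X = ?d' X + of_bool (t a \<in> X \<and> h b \<in> X)"
      using in_cut_split[OF assms(1) a(1) b(1) a(2), of h t X] a(3) by (simp add: v_def)
    then have "t a \<in> X \<and> h b \<in> X \<and> ?d X \<le> l"
      using X cut[OF X(1)] by (auto split: if_splits simp: of_bool_def)
    then show ?thesis using X by (auto simp: crit_def)
  qed
  have union: "\<exists>X. crit X \<and> t ` J \<subseteq> X" if "finite J" "J \<noteq> {}" "J \<subseteq> I" for J
    using that
  proof (induction rule: finite_ne_induct)
    case (singleton a)
    then show ?case using bad by auto
  next
    case (insert a J)
    then have "a \<in> I" "J \<subseteq> I" by auto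
    then obtain X Y where XY: "crit X" "t ` J \<subseteq> X" "crit Y" "t a \<in> Y"
      using bad[of a] insert.IH by blast
    then have "crit (X \<union> Y)"
      using tight_union[of A t h S l b X Y] assms(1,2) cut b(1) by (auto simp: crit_def v_def)
    moreover have "t ` insert a J \<subseteq> X \<union> Y" using XY by auto
    ultimately show ?case by blast
  qed
  have "finite I" using assms(1) by (auto simp: I_def)
  then obtain X where X: "crit X" "t ` I \<subseteq> X" using union[of I] \<open>I \<noteq> {}\<close> by blast
  have "?d (insert v X) < ?d X"
    unfolding in_cut_def
  proof (rule psubset_card_mono)
    have "b \<in> {a \<in> A. t a \<notin> X \<and> h a \<in> X} - {a \<in> A. t a \<notin> insert v X \<and> h a \<in> insert v X}"
      using b X by (auto simp: crit_def v_def)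
    moreover have "{a \<in> A. t a \<notin> insert v X \<and> h a \<in> insert v X} \<subseteq> {a \<in> A. t a \<notin> X \<and> h a \<in> X}"
      using X by (auto simp: I_def)
    ultimately show "{a \<in> A. t a \<notin> insert v X \<and> h a \<in> insert v X} \<subset> {a \<in> A. t a \<notin> X \<and> h a \<in> X}"
      by blast
  qed (use assms(1) in auto)
  moreover have "separates (insert v X) S" using X b by (auto simp: crit_def separates_def v_def)
  ultimately show False using cut[of "insert v X"] X by (auto simp: crit_def)
qed

text \<open>Whichever arc set contains the merged arc \<open>a\<close> receives \<open>b\<close> as well. At most one does, so the arc sets
remain disjoint.\<close>

lemma packs_unsplit:
  assumes "packs (A - {b}) t (h(a := h b)) r S l" "b \<in> A" "a \<noteq> b" "h a = t b"
  shows "packs A t h r S l"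
proof -
  let ?h = "h(a := h b)"
  obtain B where "\<forall>i<l. B i \<subseteq> A - {b} \<and> (\<forall>s\<in>S. (r, s) \<in> (arc_rel t ?h (B i))\<^sup>*)"
      "\<forall>i<l. \<forall>j<l. i \<noteq> j \<longrightarrow> B i \<inter> B j = {}"
    using assms(1) unfolding packs_def by (elim exE conjE)
  then have B: "\<And>i. i < l \<Longrightarrow> B i \<subseteq> A - {b}"
      "\<And>i s. i < l \<Longrightarrow> s \<in> S \<Longrightarrow> (r, s) \<in> (arc_rel t ?h (B i))\<^sup>*"
      "\<And>i j. i < l \<Longrightarrow> j < l \<Longrightarrow> i \<noteq> j \<Longrightarrow> B i \<inter> B j = {}"
    by simp_all
  define B' where "B' i = B i \<union> (if a \<in> B i then {b} else {})" for i
  have "arc_rel t ?h (B i) \<subseteq> (arc_rel t h (B' i))\<^sup>*" for i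
  proof
    fix p assume "p \<in> arc_rel t ?h (B i)"
    then obtain c where c: "c \<in> B i" "p = (t c, ?h c)" by blast
    show "p \<in> (arc_rel t h (B' i))\<^sup>*"
    proof (cases "c = a")
      case True
      then have "(t a, h a) \<in> arc_rel t h (B' i)" "(h a, h b) \<in> arc_rel t h (B' i)"
        using c assms(4) by (auto simp: B'_def)
      then show ?thesis using c True by (auto intro: rtrancl_into_rtrancl)
    next
      case False
      then show ?thesis using c by (auto simp: B'_def)
    qed
  qed
  then have sub: "(arc_rel t ?h (B i))\<^sup>* \<subseteq> (arc_rel t h (B' i))\<^sup>*" for i
    by (rule rtrancl_subset_rtrancl)
  show ?thesis unfolding packs_def
  proof (intro exI[of _ B'] conjI allI impI ballI)
    fix i assume i: "i < l"
    show "B' i \<subseteq> A" using B(1)[OF i] assms(2) by (auto simp: B'_def)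
    show "(r, s) \<in> (arc_rel t h (B' i))\<^sup>*" if "s \<in> S" for s using B(2)[OF i that] sub by blast
    fix j assume j: "j < l" "i \<noteq> j"
    show "B' i \<inter> B' j = {}"
      using B(1)[OF i] B(1)[OF j(1)] B(3)[OF i j] by (auto simp: B'_def)
  qed
qed

text \<open>Every splitting removes an arc, hence the induction. It stops when no arc other than a loop leaves a
vertex outside \<open>S\<close>; by balance none enters such a vertex either, and Edmonds' theorem applies to the
arcs inside \<open>S\<close>.\<close>

theorem balanced_packing:
  assumes "finite A" "finite S" "r \<in> S" "balanced A t h"
    and "\<And>X. separates X S \<Longrightarrow> l \<le> in_cut A t h X"
  shows "packs A t h r S l"
  using assms
proof (induction "card A" arbitrary: A h rule: less_induct)
  case less
  note fin = less.prems(1) and bal = less.prems(4) and cut = less.prems(5)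
  show ?case
  proof (cases "\<exists>b\<in>A. t b \<notin> S \<and> h b \<noteq> t b")
    case True
    then obtain b where b: "b \<in> A" "t b \<notin> S" "h b \<noteq> t b" by blast
    obtain a where a: "a \<in> A" "a \<noteq> b" "h a = t b"
      and cut': "\<And>X. separates X S \<Longrightarrow> l \<le> in_cut (A - {b}) t (h(a := h b)) X"
      using splitting_off[OF fin bal cut b] by blast
    have "packs (A - {b}) t (h(a := h b)) r S l"
    proof (rule less.hyps)
      show "card (A - {b}) < card A" using fin b(1) by (rule card_Diff1_less)
    qed (use fin assms(2,3) cut' balanced_split[OF fin bal a(1) b(1) a(2,3)] in auto)
    then show ?thesis using b(1) a(2,3) by (rule packs_unsplit)
  next
    case False
    have enter: "0 < in_cut A t h {v} \<Longrightarrow> v \<in> S" for v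
    proof -
      assume "0 < in_cut A t h {v}"
      then have "0 < in_cut A t h (- {v})" by (simp add: balanced_in_cut_Compl[OF fin bal])
      then show "v \<in> S" by (rule in_cut_pos_arc) (use False in auto)
    qed
    have inside: "t a \<in> S \<and> h a \<in> S" if "a \<in> A" "t a \<noteq> h a" for a
    proof -
      have "0 < in_cut A t h {h a}" unfolding in_cut_def using that fin by (auto simp: card_gt_0_iff)
      then show ?thesis using enter False that by metis
    qed
    define A' where "A' = {a \<in> A. t a \<in> S \<and> h a \<in> S}"
    have "packs A' t h r S l"
    proof (rule edmonds_branchings)
      fix X assume X: "X \<subseteq> S - {r}" "X \<noteq> {}"
      have "t a \<in> S \<and> h a \<in> S" if "a \<in> A" "t a \<notin> X" "h a \<in> X" for a
        using inside[of a] that by metis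
      then have "in_cut A t h X = in_cut A' t h X"
        unfolding in_cut_def A'_def by (intro arg_cong[where f=card]) auto
      then show "l \<le> in_cut A' t h X"
        using cut[of X] X less.prems(3) by (auto simp: separates_def)
    qed (use fin less.prems(2,3) in \<open>auto simp: A'_def\<close>)
    moreover have "A' \<subseteq> A" by (auto simp: A'_def)
    ultimately show ?thesis by (rule packs_mono)
  qed
qed


section \<open>Out-trees\<close>

text \<open>A directed walk is a walk of the underlying undirected graph, whose arcs are the pairs of ends. The
next three lemmas carry directed cycles over, so that \<^const>\<open>oriented_tree\<close> excludes them.\<close>

lemma (in pre_digraph) map_arc_to_ends_awalk_verts:
  "pre_digraph.awalk_verts (with_proj (mk_symmetric G)) u (map (arc_to_ends G) p) = awalk_verts u p"
  by (induction p arbitrary: u) (simp_all add: pre_digraph.awalk_verts.simps arc_to_ends_def)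

lemma (in pre_digraph) map_arc_to_ends_cas:
  "pre_digraph.cas (with_proj (mk_symmetric G)) u (map (arc_to_ends G) p) v = cas u p v"
  by (induction p arbitrary: u) (simp_all add: pre_digraph.cas.simps arc_to_ends_def)

lemma (in pre_digraph) cycle_mk_symmetric:
  assumes "cycle c"
  shows "pre_digraph.cycle (with_proj (mk_symmetric G)) (map (arc_to_ends G) c)"
proof -
  obtain u where u: "u \<in> verts G" "set c \<subseteq> arcs G" "cas u c u" "distinct (tl (awalk_verts u c))" "c \<noteq> []"
    using assms by (auto simp: cycle_def awalk_def)
  have "set (map (arc_to_ends G) c) \<subseteq> parcs (mk_symmetric G)"
    using u(2) by (auto simp: parcs_mk_symmetric arc_to_ends_def)
  then have "pre_digraph.awalk (with_proj (mk_symmetric G)) u (map (arc_to_ends G) c) u"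
    using u(1,3) map_arc_to_ends_cas[of u c u] by (simp add: pre_digraph.awalk_def)
  then show ?thesis
    using u(4,5) map_arc_to_ends_awalk_verts[of u c] by (auto simp: pre_digraph.cycle_def)
qed

lemma (in fin_digraph) cycle_if_all_have_predecessor:
  assumes "Z \<noteq> {}" "\<forall>v\<in>Z. \<exists>u\<in>Z. u \<rightarrow>\<^bsub>G\<^esub> v"
  shows "\<exists>c. cycle c"
proof -
  have "\<not> acyclic (arcs_ends G)"
  proof
    assume "acyclic (arcs_ends G)"
    moreover have "finite (arcs_ends G)" by (simp add: arcs_ends_def)
    ultimately have "wf (arcs_ends G)" by (rule finite_acyclic_wf[rotated])
    with assms show False by (meson ex_in_conv wfE_min)
  qed
  then obtain x where "x \<rightarrow>\<^sup>+ x" by (auto simp: acyclic_def)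
  then obtain p where "awalk x p x" "p \<noteq> []" by (auto simp: reachable1_awalk)
  then have "closed_w p" by (auto simp: closed_w_def)
  then show ?thesis by (rule closed_w_imp_cycle)
qed

text \<open>The in-arc of a vertex that \<open>r\<close> does not reach starts at another such vertex, so unreached vertices
would give a directed cycle. In an oriented tree it can have neither length 2, as no two arcs are
opposite, nor length at least 3, as the underlying graph is acyclic.\<close>

lemma out_tree_reaches:
  assumes "out_tree T r" "v \<in> verts T"
  shows "r \<rightarrow>\<^sup>*\<^bsub>T\<^esub> v"
proof (rule ccontr)
  assume unreached: "\<not> r \<rightarrow>\<^sup>*\<^bsub>T\<^esub> v"
  interpret digraph T using assms by (simp add: out_tree_def oriented_tree_def)
  define Z where "Z = {v \<in> verts T. \<not> r \<rightarrow>\<^sup>*\<^bsub>T\<^esub> v}"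
  have "\<exists>u\<in>Z. u \<rightarrow>\<^bsub>T\<^esub> w" if "w \<in> Z" for w
  proof -
    have "w \<noteq> r" using that assms(1) by (auto simp: Z_def out_tree_def)
    then have "in_degree T w = 1" using that assms(1) by (auto simp: Z_def out_tree_def)
    then obtain e where "in_arcs T w = {e}" unfolding in_degree_def by (rule card_1_singletonE)
    then have "e \<in> in_arcs T w" by simp
    then have e: "e \<in> arcs T" "head T e = w" by simp_all
    then have "tail T e \<rightarrow>\<^bsub>T\<^esub> w" by (auto simp: arcs_ends_conv)
    moreover have "tail T e \<in> Z"
      using that e(1) calculation by (auto simp: Z_def intro: reachable_adj_trans)
    ultimately show ?thesis by blast
  qed
  moreover have "Z \<noteq> {}" using unreached assms(2) by (auto simp: Z_def)
  ultimately obtain c where c: "cycle c" using cycle_if_all_have_predecessor[of Z] by blast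
  have "length c \<noteq> 2"
  proof
    assume "length c = 2"
    then obtain e f where "c = [e, f]" by (auto simp: length_Suc_conv numeral_2_eq_2)
    with c obtain u where "awalk u [e, f] u" by (auto simp: cycle_def)
    then have "(tail T e, head T e) \<in> arcs_ends T" "(head T e, tail T e) \<in> arcs_ends T"
      by (auto simp: awalk_simps arcs_ends_conv)
    then show False using assms(1) by (auto simp: out_tree_def oriented_tree_def dest: asymD)
  qed
  then have "3 \<le> length c" using c by (auto simp: cycle_digraph_conv)
  then have "\<exists>c. pre_digraph.cycle (with_proj (mk_symmetric T)) c \<and> 3 \<le> length c"
    using cycle_mk_symmetric[OF c] by (metis length_map)
  then show False using assms(1) by (simp add: out_tree_def oriented_tree_def)
qed

lemma (in pre_digraph) cas_nth:
  assumes "cas u p v" "i < length p"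
  shows "head G (p ! i) = (if Suc i = length p then v else tail G (p ! Suc i))"
  using assms
proof (induction p arbitrary: u i)
  case (Cons e p)
  show ?case
  proof (cases i)
    case 0
    then show ?thesis using Cons.prems by (cases p) auto
  next
    case (Suc j)
    then show ?thesis using Cons by auto
  qed
qed simp

text \<open>The arcs before and after \<open>e\<close> on a cycle differ once the cycle has three arcs, and heads on a cycle
are distinct. Hence the two neighbours of \<open>head G e\<close> on the cycle, \<open>tail G e = head G e'\<close> and
\<open>head G e''\<close>, are different vertices.\<close>

lemma (in pre_digraph) cycle_neighbours:
  assumes "cycle c" "3 \<le> length c" "e \<in> set c"
  obtains e' e'' where "e' \<in> set c" "e'' \<in> set c" "head G e' = tail G e" "tail G e'' = head G e"
    "head G e' \<noteq> head G e''"
proof -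
  obtain u where u: "cas u c u" "distinct (tl (awalk_verts u c))" "c \<noteq> []"
    using assms(1) by (auto simp: cycle_def awalk_def)
  have dist: "distinct (map (head G) c)"
    using u by (simp add: awalk_verts_conv')
  have hd: "tail G (c ! 0) = u" using u(1,3) by (cases c) auto
  obtain i where i: "i < length c" "e = c ! i" using assms(3) by (auto simp: in_set_conv_nth)
  define j where "j = (if i = 0 then length c - 1 else i - 1)"
  define k where "k = (if Suc i = length c then 0 else Suc i)"
  have jk: "j < length c" "k < length c" "j \<noteq> k" using i assms(2) by (auto simp: j_def k_def)
  have "head G (c ! j) = tail G e"
    using cas_nth[OF u(1) jk(1)] i hd assms(2) by (auto simp: j_def split: if_splits)
  moreover have "tail G (c ! k) = head G e"
    using cas_nth[OF u(1) i(1)] i hd by (auto simp: k_def)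
  moreover have "head G (c ! j) \<noteq> head G (c ! k)"
    using dist jk by (simp add: distinct_conv_nth)
  ultimately show thesis using jk that by (meson nth_mem)
qed

text \<open>A depth function that increases along arcs makes a digraph with the in-degrees of an out-tree into
one. Following in-arcs backwards decreases the depth and ends in \<open>r\<close>, which gives connectedness. On
an undirected cycle, a vertex of largest depth would have two different in-neighbours.\<close>

lemma out_treeI_depth:
  fixes dep :: "'a \<Rightarrow> nat"
  assumes "digraph T" "r \<in> verts T"
    and dep: "\<And>a. a \<in> arcs T \<Longrightarrow> dep (tail T a) < dep (head T a)"
    and indeg: "\<And>v. v \<in> verts T \<Longrightarrow> in_degree T v = (if v = r then 0 else 1)"
  shows "out_tree T r"
proof -
  interpret digraph T by fact
  let ?M = "with_proj (mk_symmetric T)"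
  have "asym (arcs_ends T)"
    by (rule asymI) (auto simp: arcs_ends_conv dest!: dep)
  moreover have "connected T"
  proof -
    have reach: "r \<rightarrow>\<^sup>*\<^bsub>T\<^esub> v" if "v \<in> verts T" for v
      using that
    proof (induction "dep v" arbitrary: v rule: less_induct)
      case less
      show ?case
      proof (cases "v = r")
        case False
        then have "in_degree T v = 1" using less.prems indeg by simp
        then obtain e where "in_arcs T v = {e}" unfolding in_degree_def by (rule card_1_singletonE)
        then have "e \<in> in_arcs T v" by simp
        then have e: "e \<in> arcs T" "head T e = v" by simp_all
        then have "r \<rightarrow>\<^sup>*\<^bsub>T\<^esub> tail T e" using dep[of e] by (intro less.hyps) auto
        moreover have "tail T e \<rightarrow>\<^bsub>T\<^esub> v" using e by (auto simp: arcs_ends_conv)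
        ultimately show ?thesis by (rule reachable_adj_trans)
      qed (use assms(2) in simp)
    qed
    interpret M: pair_wf_digraph "mk_symmetric T" by (rule wellformed_mk_symmetric)
    have sym: "r \<rightarrow>\<^sup>*\<^bsub>?M\<^esub> v" "v \<rightarrow>\<^sup>*\<^bsub>?M\<^esub> r" if "v \<in> verts T" for v
    proof -
      show "r \<rightarrow>\<^sup>*\<^bsub>?M\<^esub> v" by (rule reachable_mk_symmetricI[OF reach[OF that]])
      then show "v \<rightarrow>\<^sup>*\<^bsub>?M\<^esub> r" by (rule symmetric_reachable[OF symmetric_mk_symmetric])
    qed
    show ?thesis unfolding connected_def
      using assms(2) sym by (intro strongly_connectedI) (auto intro: M.reachable_trans)
  qed
  moreover have False if c: "pre_digraph.cycle ?M c" "3 \<le> length c" for c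
  proof -
    have sub: "set c \<subseteq> parcs (mk_symmetric T)" and ne: "c \<noteq> []"
      using c by (auto simp: pre_digraph.cycle_def pre_digraph.awalk_def)
    have up: "(x, y) \<in> arcs_ends T" if xy: "(x, y) \<in> set c \<or> (y, x) \<in> set c" "dep x \<le> dep y" for x y
    proof -
      obtain a where "a \<in> arcs T" "tail T a = x \<and> head T a = y \<or> tail T a = y \<and> head T a = x"
        using xy(1) sub unfolding parcs_mk_symmetric by blast
      then show ?thesis using dep[of a] xy(2) by (auto simp: arcs_ends_conv)
    qed
    let ?m = "Max ((\<lambda>f. dep (snd f)) ` set c)"
    have "?m \<in> (\<lambda>f. dep (snd f)) ` set c" using ne by (intro Max_in) auto
    then obtain e where "e \<in> set c" "?m = dep (snd e)" by blast
    then have e: "e \<in> set c" "\<And>f. f \<in> set c \<Longrightarrow> dep (snd f) \<le> dep (snd e)"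
      using Max_ge[of "(\<lambda>f. dep (snd f)) ` set c"] by auto
    obtain e' e'' where "e' \<in> set c" "e'' \<in> set c" "head ?M e' = tail ?M e" "tail ?M e'' = head ?M e"
      "head ?M e' \<noteq> head ?M e''"
      by (rule pre_digraph.cycle_neighbours[OF c e(1)])
    then have n: "e' \<in> set c" "e'' \<in> set c" "snd e' = fst e" "fst e'' = snd e" "snd e' \<noteq> snd e''"
      by simp_all
    have "(fst e, snd e) \<in> arcs_ends T"
      using e(1) e(2)[OF n(1)] n by (intro up) auto
    moreover have "(snd e'', snd e) \<in> arcs_ends T"
      using e(2)[OF n(2)] n(2) by (intro up) (auto simp: n(4)[symmetric])
    ultimately obtain a b where ab: "a \<in> in_arcs T (snd e)" "b \<in> in_arcs T (snd e)"
      "tail T a = fst e" "tail T b = snd e''" by (auto simp: arcs_ends_conv)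
    then have "snd e \<in> verts T" using head_in_verts[of a] by simp
    then have "card (in_arcs T (snd e)) \<le> 1" using indeg by (auto simp: in_degree_def)
    then have "a = b" using ab(1,2) card_le_Suc0_iff_eq[OF finite_in_arcs] by auto
    then show False using ab n by simp
  qed
  ultimately show ?thesis
    unfolding out_tree_def oriented_tree_def using assms indeg by auto
qed

text \<open>The tree consists of the vertices that \<open>r\<close> reaches through \<open>B\<close>; each of them except \<open>r\<close> chooses as its
in-arc the last arc of a shortest walk from \<open>r\<close>. The distance from \<open>r\<close> is the depth function.\<close>

lemma steiner_out_tree_exists:
  assumes "digraph D" "B \<subseteq> arcs D" "r \<in> verts D"
    and S: "\<forall>s\<in>S. (r, s) \<in> (arc_rel (tail D) (head D) B)\<^sup>*"
  obtains T where "steiner_out_tree D S r T" "arcs T \<subseteq> B"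
proof -
  interpret D: digraph D by fact
  let ?R = "arc_rel (tail D) (head D) B"
  define U where "U = {v. (r, v) \<in> ?R\<^sup>*}"
  define dep where "dep v = (LEAST n. (r, v) \<in> ?R ^^ n)" for v
  have dep: "(r, v) \<in> ?R ^^ dep v" if "v \<in> U" for v
    using that unfolding dep_def U_def by (auto intro: LeastI_ex dest: rtrancl_imp_relpow)
  have UV: "U \<subseteq> verts D"
  proof
    fix v assume "v \<in> U"
    then have "(r, v) \<in> ?R\<^sup>*" by (simp add: U_def)
    then show "v \<in> verts D" by (induction) (use assms(2,3) in auto)
  qed
  have "\<exists>e\<in>B. head D e = v \<and> tail D e \<in> U \<and> dep (tail D e) < dep v" if v: "v \<in> U - {r}" for v
  proof (cases "dep v")
    case 0
    then show ?thesis using dep[of v] v by auto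
  next
    case (Suc n)
    then have "(r, v) \<in> ?R ^^ Suc n" using dep[of v] v by auto
    then obtain w where w: "(r, w) \<in> ?R ^^ n" "(w, v) \<in> ?R" by auto
    have "dep w \<le> n" unfolding dep_def using w(1) by (rule Least_le)
    moreover have "w \<in> U" unfolding U_def using w(1) by (auto dest: relpow_imp_rtrancl)
    ultimately show ?thesis using w(2) Suc by auto
  qed
  then obtain par where par: "\<And>v. v \<in> U - {r} \<Longrightarrow>
      par v \<in> B \<and> head D (par v) = v \<and> tail D (par v) \<in> U \<and> dep (tail D (par v)) < dep v"
    by metis
  define T where "T = \<lparr>verts = U, arcs = par ` (U - {r}), tail = tail D, head = head D\<rparr>"
  have T [simp]: "verts T = U" "arcs T = par ` (U - {r})" "tail T = tail D" "head T = head D"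
    by (simp_all add: T_def)
  have arcsT: "arcs T \<subseteq> B" using par by (simp add: image_subset_iff)
  have rU: "r \<in> U" by (simp add: U_def)
  have dT: "digraph T"
  proof
    show "finite (verts T)" "finite (arcs T)" using UV finite_subset[OF UV] by auto
    fix e assume "e \<in> arcs T"
    then obtain v where "v \<in> U - {r}" "e = par v" by auto
    then show "tail T e \<in> verts T" "head T e \<in> verts T" using par[of v] by auto
    show "tail T e \<noteq> head T e" using \<open>e \<in> arcs T\<close> arcsT assms(2) D.no_loops by auto
    fix f assume "f \<in> arcs T" "arc_to_ends T e = arc_to_ends T f"
    then show "e = f"
      using \<open>e \<in> arcs T\<close> arcsT assms(2) by (intro D.no_multi_arcs) (auto simp: arc_to_ends_def)
  qed
  have ins: "in_arcs T v = (if v = r then {} else {par v})" if "v \<in> U" for v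
  proof -
    have "{e \<in> par ` (U - {r}). head D e = v} = par ` {w \<in> U - {r}. head D (par w) = v}" by blast
    also have "{w \<in> U - {r}. head D (par w) = v} = {w \<in> U - {r}. w = v}"
      by (rule Collect_cong) (metis par)
    also have "\<dots> = (if v = r then {} else {v})" using that by auto
    finally show ?thesis by (simp add: in_arcs_def)
  qed
  have "out_tree T r"
  proof (rule out_treeI_depth[where dep = dep])
    show "in_degree T v = (if v = r then 0 else 1)" if "v \<in> verts T" for v
      using ins that by (simp add: in_degree_def)
    fix a assume "a \<in> arcs T"
    then obtain v where "v \<in> U - {r}" "a = par v" by auto
    then show "dep (tail T a) < dep (head T a)" using par[of v] by simp
  qed (use dT rU in simp_all)
  moreover have "subgraph T D"
    using UV arcsT assms(2) dT D.wf_digraph_axioms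
    by (auto simp: subgraph_def compatible_def digraph_def fin_digraph_def)
  moreover have "S \<subseteq> U" using S by (auto simp: U_def)
  ultimately have "steiner_out_tree D S r T" by (simp add: steiner_out_tree_def)
  then show thesis using arcsT by (rule that)
qed

section \<open>The two connectivity numbers\<close>

lemma le_Max_card_iff:
  assumes "finite \<U>"
  shows "l \<le> Max {card F | F. F \<subseteq> \<U> \<and> pairwise R F} \<longleftrightarrow> (\<exists>F. F \<subseteq> \<U> \<and> pairwise R F \<and> l \<le> card F)"
proof -
  have "{card F | F. F \<subseteq> \<U> \<and> pairwise R F} = card ` {F \<in> Pow \<U>. pairwise R F}" by auto
  then have "finite {card F | F. F \<subseteq> \<U> \<and> pairwise R F}" using assms by simp
  moreover have "card {} \<in> {card F | F. F \<subseteq> \<U> \<and> pairwise R F}" by (auto intro!: exI[of _ "{}"])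
  ultimately show ?thesis by (subst Max_ge_iff) auto
qed

lemma finite_steiner_out_trees:
  assumes "digraph D"
  shows "finite {T. steiner_out_tree D S r T}"
proof (rule finite_subset)
  interpret digraph D by fact
  let ?mk = "\<lambda>(V, A). \<lparr>verts = V, arcs = A, tail = tail D, head = head D\<rparr>"
  show "finite (?mk ` (Pow (verts D) \<times> Pow (arcs D)))" by simp
  show "{T. steiner_out_tree D S r T} \<subseteq> ?mk ` (Pow (verts D) \<times> Pow (arcs D))"
  proof
    fix T assume "T \<in> {T. steiner_out_tree D S r T}"
    then have "subgraph T D" by (simp add: steiner_out_tree_def)
    then have "T = ?mk (verts T, arcs T)" "(verts T, arcs T) \<in> Pow (verts D) \<times> Pow (arcs D)"
      by (auto simp: subgraph_def compatible_def)
    then show "T \<in> ?mk ` (Pow (verts D) \<times> Pow (arcs D))" by (rule image_eqI)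
  qed
qed

lemma (in wf_digraph) awalk_enters:
  assumes "awalk u p v" "u \<notin> X" "v \<in> X"
  shows "\<exists>a\<in>set p. tail G a \<notin> X \<and> head G a \<in> X"
  using assms
proof (induction p arbitrary: u)
  case (Cons e p)
  then show ?case by (cases "head G e \<in> X") (auto simp: awalk_Cons_iff)
qed (auto simp: awalk_Nil_iff)

text \<open>Each of the paths enters \<open>X\<close>, and disjoint paths do so through different arcs.\<close>

lemma arc_connectivity_le_in_cut:
  assumes "digraph D" "r \<notin> X" "s \<in> X"
  shows "arc_connectivity D r s \<le> in_cut (arcs D) (tail D) (head D) X"
proof -
  interpret digraph D by fact
  obtain F where F: "F \<subseteq> {p. apath r p s}" "pairwise (\<lambda>p q. set p \<inter> set q = {}) F"
      "arc_connectivity D r s \<le> card F"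
    using le_Max_card_iff[OF apaths_finite] unfolding arc_connectivity_def by blast
  have "\<exists>a\<in>set p. tail D a \<notin> X \<and> head D a \<in> X" if "p \<in> F" for p
    using that F(1) assms(2,3) awalk_enters[of r p s X] by (auto simp: apath_def)
  then obtain f where f: "\<And>p. p \<in> F \<Longrightarrow> f p \<in> set p \<and> tail D (f p) \<notin> X \<and> head D (f p) \<in> X"
    by metis
  have "inj_on f F"
  proof (rule inj_onI, rule ccontr)
    fix p q assume pq: "p \<in> F" "q \<in> F" "f p = f q" "p \<noteq> q"
    then have "set p \<inter> set q = {}" using F(2) by (simp add: pairwise_def)
    then show False using f[OF pq(1)] f[OF pq(2)] pq(3) by auto
  qed
  then have "card F = card (f ` F)" by (simp add: card_image)
  also have "\<dots> \<le> in_cut (arcs D) (tail D) (head D) X"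
    unfolding in_cut_def
  proof (rule card_mono)
    show "f ` F \<subseteq> {a \<in> arcs D. tail D a \<notin> X \<and> head D a \<in> X}"
      using f F(1) by (fastforce simp: apath_def awalk_def)
  qed simp
  finally show ?thesis using F(3) by simp
qed

lemma tree_connectivity_le_arc_connectivity:
  assumes "digraph D" "s \<in> S" "s \<noteq> r"
  shows "tree_connectivity D S r \<le> arc_connectivity D r s"
proof -
  interpret digraph D by fact
  obtain F where F: "F \<subseteq> {T. steiner_out_tree D S r T}"
      "pairwise (\<lambda>T1 T2. arcs T1 \<inter> arcs T2 = {}) F" "tree_connectivity D S r \<le> card F"
    using le_Max_card_iff[OF finite_steiner_out_trees[OF assms(1)]] unfolding tree_connectivity_def by blast
  have "\<exists>p. apath r p s \<and> set p \<subseteq> arcs T" if "T \<in> F" for T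
  proof -
    have T: "subgraph T D" "out_tree T r" "s \<in> verts T"
      using that F(1) assms(2) by (auto simp: steiner_out_tree_def)
    interpret T: wf_digraph T using T(1) by (simp add: subgraph_def)
    obtain p where p: "T.apath r p s" using out_tree_reaches[OF T(2,3)] T.reachable_apath by blast
    then have "apath r p s" using T(1) by (rule subgraph_apath_imp_apath)
    moreover have "set p \<subseteq> arcs T" using p by (auto simp: T.apath_def)
    ultimately show ?thesis by blast
  qed
  then obtain f where f: "\<And>T. T \<in> F \<Longrightarrow> apath r (f T) s \<and> set (f T) \<subseteq> arcs T" by metis
  have disj: "set (f T1) \<inter> set (f T2) = {}" if "T1 \<in> F" "T2 \<in> F" "T1 \<noteq> T2" for T1 T2
    using f[OF that(1)] f[OF that(2)] pairwiseD[OF F(2) that] by blast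
  have ne: "f T \<noteq> []" if "T \<in> F" for T
    using f[OF that] assms(3) by (auto simp: apath_Nil_iff)
  have "inj_on f F"
  proof (rule inj_onI, rule ccontr)
    fix T1 T2 assume T: "T1 \<in> F" "T2 \<in> F" "f T1 = f T2" "T1 \<noteq> T2"
    then show False using disj[OF T(1,2,4)] ne[OF T(2)] by simp
  qed
  then have "card (f ` F) = card F" by (rule card_image)
  moreover have "f ` F \<subseteq> {p. apath r p s}" using f by auto
  moreover have "pairwise (\<lambda>p q. set p \<inter> set q = {}) (f ` F)"
    using disj by (auto simp: pairwise_def)
  ultimately have "card F \<le> arc_connectivity D r s"
    unfolding arc_connectivity_def by (subst le_Max_card_iff[OF apaths_finite]) (metis order_refl)
  then show ?thesis using F(3) by simp
qed

text \<open>The vertex \<open>s\<close> ensures that every tree has an arc, so that disjoint trees are different members of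
the family.\<close>

lemma packs_le_tree_connectivity:
  assumes "digraph D" "r \<in> verts D" "s \<in> S" "s \<noteq> r"
    and "packs (arcs D) (tail D) (head D) r S l"
  shows "l \<le> tree_connectivity D S r"
proof -
  obtain B where B: "\<forall>i<l. B i \<subseteq> arcs D \<and> (\<forall>s\<in>S. (r, s) \<in> (arc_rel (tail D) (head D) (B i))\<^sup>*)"
      "\<forall>i<l. \<forall>j<l. i \<noteq> j \<longrightarrow> B i \<inter> B j = {}"
    using assms(5) unfolding packs_def by (elim exE conjE)
  have "\<exists>T. steiner_out_tree D S r T \<and> arcs T \<subseteq> B i" if "i < l" for i
    using steiner_out_tree_exists[of D "B i" r S] assms(1,2) B(1) that by metis
  then obtain T where T: "\<And>i. i < l \<Longrightarrow> steiner_out_tree D S r (T i) \<and> arcs (T i) \<subseteq> B i" by metis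
  have disj: "arcs (T i) \<inter> arcs (T j) = {}" if "i < l" "j < l" "i \<noteq> j" for i j
    using T[OF that(1)] T[OF that(2)] B(2) that by blast
  have ne: "arcs (T i) \<noteq> {}" if "i < l" for i
  proof
    assume "arcs (T i) = {}"
    then have "in_degree (T i) s = 0" by (simp add: in_degree_def in_arcs_def)
    moreover have "in_degree (T i) s = 1"
      using T[OF that] assms(3,4) by (auto simp: steiner_out_tree_def out_tree_def)
    ultimately show False by simp
  qed
  have "inj_on T {..<l}"
  proof (rule inj_onI, rule ccontr)
    fix i j assume ij: "i \<in> {..<l}" "j \<in> {..<l}" "T i = T j" "i \<noteq> j"
    then show False using disj[of i j] ne[of j] by simp
  qed
  then have "card (T ` {..<l}) = l" by (simp add: card_image)
  moreover have "T ` {..<l} \<subseteq> {T. steiner_out_tree D S r T}" using T by auto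
  moreover have "pairwise (\<lambda>T1 T2. arcs T1 \<inter> arcs T2 = {}) (T ` {..<l})"
    using disj by (auto simp: pairwise_def)
  ultimately show ?thesis
    unfolding tree_connectivity_def
    by (subst le_Max_card_iff[OF finite_steiner_out_trees[OF assms(1)]]) (metis order_refl)
qed

theorem theorem1p1:
  fixes D :: "('a, 'b) pre_digraph" and S :: "'a set" and r :: 'a and l :: nat
  assumes "eulerian D"
    and "S \<subseteq> verts D" and "card S \<ge> 2" and "r \<in> S"
    and "l \<ge> 1"
  shows "tree_connectivity D S r \<ge> l \<longleftrightarrow> (\<forall>s \<in> S - {r}. arc_connectivity D r s \<ge> l)"
proof (intro iffI ballI)
  have D: "digraph D" using assms(1) by (simp add: eulerian_def)
  interpret digraph D by (rule D)
  {
    fix s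
    assume "tree_connectivity D S r \<ge> l" "s \<in> S - {r}"
    then show "arc_connectivity D r s \<ge> l"
      using tree_connectivity_le_arc_connectivity[OF D, of s S r] by simp
  }
  assume conn: "\<forall>s \<in> S - {r}. arc_connectivity D r s \<ge> l"
  have bal: "balanced (arcs D) (tail D) (head D)"
    unfolding balanced_def
  proof
    fix v
    show "card {a \<in> arcs D. tail D a = v} = card {a \<in> arcs D. head D a = v}"
    proof (cases "v \<in> verts D")
      case True
      then show ?thesis
        using assms(1) by (simp add: eulerian_def out_degree_def in_degree_def out_arcs_def in_arcs_def)
    next
      case False
      then have "{a \<in> arcs D. tail D a = v} = {}" "{a \<in> arcs D. head D a = v} = {}" by auto
      then show ?thesis by (simp only:)
    qed
  qed
  have "S - {r} \<noteq> {}"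
  proof
    assume "S - {r} = {}"
    then have "S \<subseteq> {r}" by blast
    then have "card S \<le> 1" using card_mono[of "{r}" S] by simp
    then show False using assms(3) by simp
  qed
  then obtain s where s: "s \<in> S" "s \<noteq> r" by blast
  have "packs (arcs D) (tail D) (head D) r S l"
  proof (rule balanced_packing)
    show "finite S" using assms(2) finite_verts finite_subset by blast
    fix X assume X: "separates X S"
    show "l \<le> in_cut (arcs D) (tail D) (head D) X"
    \<comment> \<open>Paths from \<open>r\<close> enter whichever of \<open>X\<close> and its complement avoids \<open>r\<close>.\<close>
    proof (cases "r \<in> X")
      case False
      then obtain x where "x \<in> X" "x \<in> S - {r}" using X by (auto simp: separates_def)
      then show ?thesis using arc_connectivity_le_in_cut[OF D False] conn by (meson order_trans)
    next
      case True
      then obtain x where "x \<in> - X" "x \<in> S - {r}" "r \<notin> - X" using X by (auto simp: separates_def)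
      then have "l \<le> in_cut (arcs D) (tail D) (head D) (- X)"
        using arc_connectivity_le_in_cut[OF D] conn by (meson order_trans)
      then show ?thesis by (simp add: balanced_in_cut_Compl[OF finite_arcs bal])
    qed
  qed (use assms(4) bal in auto)
  then show "tree_connectivity D S r \<ge> l"
    using packs_le_tree_connectivity[OF D _ s] assms(2,4) by blast
qed

end
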